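(* If games $G_1$ and $G_2$ are miserable, then their disjunctive sum $G_1+G_2$ is miserable. Moreover, a position $x=(x_1,x_2)$ of $G_1+G_2$ is a swap position if and only if $x_i$ is a swap position of $G_i$ for $i=1,2$; and $x$ is a $(1,0)$-position of $G_1+G_2$ if and only if one of $x_1,x_2$ is a $(1,0)$-position (in its game) and the other is a $(0,1)$-position (in its game).
   Context: A game is a two-player impartial game given by a directed acyclic graph whose vertices are positions and whose arcs are moves, such that from every position only finitely many positions are reachable. A position with no moves is terminal. $\operatorname{mex}(S)$ is the least non-negative integer not in $S$. The normal Sprague–Grundy function is $\mathcal{G}(x)=\operatorname{mex}\{\mathcal{G}(y): x\to y\}$ (so $0$ on terminal positions); the misère Sprague–Grundy function $\mathcal{G}^-$ satisfies $\mathcal{G}^-(x)=1$ for terminal $x$ and $\mathcal{G}^-(x)=\operatorname{mex}\{\mathcal{G}^-(y): x\to y\}$ otherwise. An $(i,j)$-position is a position $x$ with $\mathcal{G}(x)=i$, $\mathcal{G}^-(x)=j$, and $V_{i,j}$ the set of them; a swap position is a position in $V_{0,1}\cup V_{1,0}$. A position $x$ is movable to a set $W$ if there is a move from $x$ to some position of $W$. A game is miserable if every position $x$ satisfies at least one of: (a) $x$ is a swap position; (b) $x$ is not movable to $V_{0,1}\cup V_{1,0}$; (c) $x$ is movable to $V_{0,1}$ and to $V_{1,0}$. The disjunctive sum $G_1+G_2$ has positions $(x_1,x_2)$ with $x_i$ a position of $G_i$; a move consists of choosing one $i$ and making a move $x_i\to x_i'$ in $G_i$, leaving the other coordinate unchanged.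 The functions $\mathcal{G},\mathcal{G}^-$ of the sum are computed in the sum itself (so a position of the sum is terminal iff both coordinates are terminal). *)

theory Defs
  imports "Graph_Theory.Pair_Digraph"
begin

text \<open>
  A game is a digraph without parallel arcs: vertices are positions, arcs are moves. The digraph
  itself may be infinite; only the part reachable from each position has to be finite.
\<close>

locale game = pair_wf_digraph G for G :: "'a pair_pre_digraph" +
  assumes acyclic_moves: "acyclic (parcs G)"
    and finite_reachable: "x \<in> pverts G \<Longrightarrow> finite {y. x \<rightarrow>\<^sup>*\<^bsub>with_proj G\<^esub> y}"

abbreviation options :: "'a pair_pre_digraph \<Rightarrow> 'a \<Rightarrow> 'a set" where
  "options G x \<equiv> {y. (x, y) \<in> parcs G}"

definition terminal :: "'a pair_pre_digraph \<Rightarrow> 'a \<Rightarrow> bool" where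
  "terminal G x \<longleftrightarrow> options G x = {}"

definition mex :: "nat set \<Rightarrow> nat" where
  "mex S = (LEAST n. n \<notin> S)"

text \<open>
  The two recursions run along the converse of the move relation, which is well-founded in every
  game (\<open>game.wf_moves\<close>); the recursion equations are \<open>game.grundy_eq\<close>,
  \<open>game.misere_grundy_terminal\<close> and \<open>game.misere_grundy_eq\<close>.
\<close>

definition grundy :: "'a pair_pre_digraph \<Rightarrow> 'a \<Rightarrow> nat" where
  "grundy G = wfrec ((parcs G)\<inverse>) (\<lambda>g x. mex (g ` options G x))"

definition misere_grundy :: "'a pair_pre_digraph \<Rightarrow> 'a \<Rightarrow> nat" where
  "misere_grundy G =
    wfrec ((parcs G)\<inverse>) (\<lambda>g x. if terminal G x then 1 else mex (g ` options G x))"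

definition V :: "'a pair_pre_digraph \<Rightarrow> nat \<Rightarrow> nat \<Rightarrow> 'a set" where
  "V G i j = {x \<in> pverts G. grundy G x = i \<and> misere_grundy G x = j}"

definition swap_positions :: "'a pair_pre_digraph \<Rightarrow> 'a set" where
  "swap_positions G = V G 0 1 \<union> V G 1 0"

definition movable :: "'a pair_pre_digraph \<Rightarrow> 'a \<Rightarrow> 'a set \<Rightarrow> bool" where
  "movable G x W \<longleftrightarrow> (\<exists>y\<in>W. (x, y) \<in> parcs G)"

definition miserable :: "'a pair_pre_digraph \<Rightarrow> bool" where
  "miserable G \<longleftrightarrow>
    (\<forall>x\<in>pverts G.
      x \<in> swap_positions G \<or>
      \<not> movable G x (V G 0 1 \<union> V G 1 0) \<or>
      (movable G x (V G 0 1) \<and> movable G x (V G 1 0)))"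

definition disjunctive_sum ::
  "'a pair_pre_digraph \<Rightarrow> 'b pair_pre_digraph \<Rightarrow> ('a \<times> 'b) pair_pre_digraph" where
  "disjunctive_sum G\<^sub>1 G\<^sub>2 =
    \<lparr> pverts = pverts G\<^sub>1 \<times> pverts G\<^sub>2,
      parcs = {((x\<^sub>1, x\<^sub>2), (y\<^sub>1, x\<^sub>2)) | x\<^sub>1 y\<^sub>1 x\<^sub>2. (x\<^sub>1, y\<^sub>1) \<in> parcs G\<^sub>1 \<and> x\<^sub>2 \<in> pverts G\<^sub>2} \<union>
              {((x\<^sub>1, x\<^sub>2), (x\<^sub>1, y\<^sub>2)) | x\<^sub>1 x\<^sub>2 y\<^sub>2. x\<^sub>1 \<in> pverts G\<^sub>1 \<and> (x\<^sub>2, y\<^sub>2) \<in> parcs G\<^sub>2} \<rparr>"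

context game
begin

lemma reachable_iff: "x \<rightarrow>\<^sup>*\<^bsub>with_proj G\<^esub> y \<longleftrightarrow> x \<in> pverts G \<and> (x, y) \<in> (parcs G)\<^sup>*"
proof
  assume "x \<rightarrow>\<^sup>*\<^bsub>with_proj G\<^esub> y"
  then show "x \<in> pverts G \<and> (x, y) \<in> (parcs G)\<^sup>*"
    unfolding reachable_def
    by (auto dest: rtrancl_on_rtranclI elim: rtrancl_on.induct)
next
  assume "x \<in> pverts G \<and> (x, y) \<in> (parcs G)\<^sup>*"
  then have "x \<in> pverts G" and "(x, y) \<in> (parcs G)\<^sup>*" by auto
  from this(2,1) show "x \<rightarrow>\<^sup>*\<^bsub>with_proj G\<^esub> y"
    unfolding reachable_def
    by (induction rule: rtrancl_induct)
       (auto intro: rtrancl_on_refl rtrancl_on_into_rtrancl_on dest: in_arcsD2)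
qed

lemma wf_moves: "wf ((parcs G)\<inverse>)"
proof (rule wf_subset)
  show "wf (measure (\<lambda>x. card {y. x \<rightarrow>\<^sup>*\<^bsub>with_proj G\<^esub> y}))" by simp
  show "(parcs G)\<inverse> \<subseteq> measure (\<lambda>x. card {y. x \<rightarrow>\<^sup>*\<^bsub>with_proj G\<^esub> y})"
  proof clarify
    fix x y assume xy: "(x, y) \<in> parcs G"
    have "(y, x) \<notin> (parcs G)\<^sup>*"
      using acyclic_moves xy rtrancl_into_trancl2[OF xy] unfolding acyclic_def by blast
    then have "{z. y \<rightarrow>\<^sup>*\<^bsub>with_proj G\<^esub> z} \<subset> {z. x \<rightarrow>\<^sup>*\<^bsub>with_proj G\<^esub> z}"
      unfolding reachable_iff using xy in_arcsD1[OF xy]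
      by (auto intro: converse_rtrancl_into_rtrancl)
    then show "(y, x) \<in> measure (\<lambda>x. card {y. x \<rightarrow>\<^sup>*\<^bsub>with_proj G\<^esub> y})"
      using psubset_card_mono[OF finite_reachable[OF in_arcsD1[OF xy]]] by simp
  qed
qed

lemma grundy_eq: "grundy G x = mex (grundy G ` options G x)"
proof -
  have "adm_wf ((parcs G)\<inverse>) (\<lambda>g x. mex (g ` options G x))"
    unfolding adm_wf_def by (auto intro!: arg_cong[where f = mex] image_cong)
  from wfrec_fixpoint[OF wf_moves this] show ?thesis
    unfolding grundy_def by metis
qed

lemma misere_grundy_unfold:
  "misere_grundy G x = (if terminal G x then 1 else mex (misere_grundy G ` options G x))"
proof -
  have "adm_wf ((parcs G)\<inverse>) (\<lambda>g x. if terminal G x then 1 else mex (g ` options G x))"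
    unfolding adm_wf_def by (auto intro!: arg_cong[where f = mex] image_cong)
  from fun_cong[OF wfrec_fixpoint[OF wf_moves this], of x] show ?thesis
    unfolding misere_grundy_def .
qed

lemma misere_grundy_terminal: "terminal G x \<Longrightarrow> misere_grundy G x = 1"
  by (simp add: misere_grundy_unfold)

lemma misere_grundy_eq:
  "\<not> terminal G x \<Longrightarrow> misere_grundy G x = mex (misere_grundy G ` options G x)"
  by (subst misere_grundy_unfold) simp

lemma finite_moves: "finite (options G x)"
proof (cases "x \<in> pverts G")
  case True
  have "options G x \<subseteq> {y. x \<rightarrow>\<^sup>*\<^bsub>with_proj G\<^esub> y}"
    using True by (auto simp: reachable_iff)
  then show ?thesis using finite_reachable[OF True] finite_subset by blast
next
  case False
  then have "options G x = {}" by (auto dest: in_arcsD1)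
  then show ?thesis by simp
qed

end

lemma game_disjunctive_sum:
  assumes "game G\<^sub>1" and "game G\<^sub>2"
  shows "game (disjunctive_sum G\<^sub>1 G\<^sub>2)"
proof -
  interpret G1: game G\<^sub>1 by fact
  interpret G2: game G\<^sub>2 by fact
  let ?S = "disjunctive_sum G\<^sub>1 G\<^sub>2"
  have wf: "pair_wf_digraph ?S"
    by unfold_locales
       (auto simp: disjunctive_sum_def dest: G1.in_arcsD1 G1.in_arcsD2 G2.in_arcsD1 G2.in_arcsD2)
  have arc_proj: "(fst p, fst q) \<in> (parcs G\<^sub>1)\<^sup>= \<and> (snd p, snd q) \<in> (parcs G\<^sub>2)\<^sup>="
    if "(p, q) \<in> parcs ?S" for p q
    using that by (auto simp: disjunctive_sum_def)
  have proj: "(fst p, fst q) \<in> (parcs G\<^sub>1)\<^sup>* \<and> (snd p, snd q) \<in> (parcs G\<^sub>2)\<^sup>*"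
    if "(p, q) \<in> (parcs ?S)\<^sup>*" for p q
    using that
  proof (induction rule: rtrancl_induct)
    case (step q r)
    then show ?case
      using arc_proj[OF step.hyps(2)]
      by (auto intro: rtrancl_into_rtrancl)
  qed simp
  have strict: "(fst p, fst q) \<in> (parcs G\<^sub>1)\<^sup>+ \<or> (snd p, snd q) \<in> (parcs G\<^sub>2)\<^sup>+"
    if pq: "(p, q) \<in> (parcs ?S)\<^sup>+" for p q
  proof -
    from pq obtain r where r: "(p, r) \<in> parcs ?S" "(r, q) \<in> (parcs ?S)\<^sup>*"
      by (meson tranclD)
    from r(1) have "(fst p, fst r) \<in> parcs G\<^sub>1 \<or> (snd p, snd r) \<in> parcs G\<^sub>2"
      by (auto simp: disjunctive_sum_def)
    with proj[OF r(2)] show ?thesis by (blast intro: rtrancl_into_trancl2)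
  qed
  show ?thesis
  proof (intro game.intro game_axioms.intro wf)
    show "acyclic (parcs ?S)"
      using strict G1.acyclic_moves G2.acyclic_moves unfolding acyclic_def by blast
  next
    fix p assume p: "p \<in> pverts ?S"
    then have v: "fst p \<in> pverts G\<^sub>1" "snd p \<in> pverts G\<^sub>2"
      by (auto simp: disjunctive_sum_def)
    have "{q. p \<rightarrow>\<^sup>*\<^bsub>with_proj ?S\<^esub> q} \<subseteq>
        {y. fst p \<rightarrow>\<^sup>*\<^bsub>with_proj G\<^sub>1\<^esub> y} \<times> {y. snd p \<rightarrow>\<^sup>*\<^bsub>with_proj G\<^sub>2\<^esub> y}"
    proof
      fix q assume "q \<in> {q. p \<rightarrow>\<^sup>*\<^bsub>with_proj ?S\<^esub> q}"
      then have "(p, q) \<in> (parcs ?S)\<^sup>*"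
        unfolding reachable_def by (auto dest: rtrancl_on_rtranclI)
      from proj[OF this]
      show "q \<in> {y. fst p \<rightarrow>\<^sup>*\<^bsub>with_proj G\<^sub>1\<^esub> y} \<times> {y. snd p \<rightarrow>\<^sup>*\<^bsub>with_proj G\<^sub>2\<^esub> y}"
        using v by (simp add: G1.reachable_iff G2.reachable_iff mem_Times_iff)
    qed
    then show "finite {q. p \<rightarrow>\<^sup>*\<^bsub>with_proj ?S\<^esub> q}"
      by (rule finite_subset)
         (intro finite_cartesian_product G1.finite_reachable G2.finite_reachable v)
  qed
qed

end

(*
  In a miserable game every position is either a swap position or satisfies grundy = misere_grundy.
  For the sum one proves the same dichotomy by induction along moves, the swap positions of the sum
  being exactly the pairs of swap positions.  Only the part of the Sprague-Grundy theorem that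
  concerns the values 0 and 1 is needed: among pairs with at most one value above 1, the sum has
  value above 1 as soon as one coordinate does, and otherwise the sum of the values modulo 2.
*)
theory Submission
  imports Defs
begin

section \<open>Minimal excluded values\<close>

lemma mex_eqI: "n \<notin> S \<Longrightarrow> (\<And>m. m < n \<Longrightarrow> m \<in> S) \<Longrightarrow> mex S = n"
  unfolding mex_def by (rule Least_equality) (auto simp: not_less[symmetric])

lemma mex_notin: "finite S \<Longrightarrow> mex S \<notin> S"
  unfolding mex_def by (rule LeastI_ex) (rule ex_new_if_finite[OF infinite_UNIV_nat])

lemma less_mex_in: "n < mex S \<Longrightarrow> n \<in> S"
  unfolding mex_def using not_less_Least by blast

section \<open>Normal and misere values in a single game\<close>

context game
begin

text \<open>An arithmetic form of the two cases: the bound below 2 keeps the natural subtraction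
  \<open>1 - grundy G x\<close> exact.\<close>

lemma swap_positions_iff:
  "x \<in> swap_positions G \<longleftrightarrow> x \<in> pverts G \<and> grundy G x < 2 \<and> misere_grundy G x = 1 - grundy G x"
  unfolding swap_positions_def V_def by auto

lemma swap_positions_neq: "x \<in> swap_positions G \<Longrightarrow> grundy G x \<noteq> misere_grundy G x"
  unfolding swap_positions_def V_def by auto

lemma grundy_terminal: "terminal G x \<Longrightarrow> grundy G x = 0"
  by (subst grundy_eq) (auto simp: terminal_def intro: mex_eqI)

lemma grundy_option_neq: "(x, y) \<in> parcs G \<Longrightarrow> grundy G y \<noteq> grundy G x"
  using mex_notin[OF finite_imageI[OF finite_moves]] grundy_eq[of x]
  by (metis imageI mem_Collect_eq)

lemma misere_grundy_option_neq: "(x, y) \<in> parcs G \<Longrightarrow> misere_grundy G y \<noteq> misere_grundy G x"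
  using mex_notin[OF finite_imageI[OF finite_moves]] misere_grundy_eq[of x]
  by (metis empty_iff imageI mem_Collect_eq terminal_def)

lemma less_grundyE:
  assumes "n < grundy G x"
  obtains y where "(x, y) \<in> parcs G" "grundy G y = n"
  using assms less_mex_in[of n "grundy G ` options G x"] grundy_eq[of x] by auto

lemma less_misere_grundyE:
  assumes "\<not> terminal G x" and "n < misere_grundy G x"
  obtains y where "(x, y) \<in> parcs G" "misere_grundy G y = n"
  using assms less_mex_in[of n "misere_grundy G ` options G x"] misere_grundy_eq[of x] by auto

lemma two_le_grundyI:
  assumes "(x, y) \<in> parcs G" "grundy G y = 0" and "(x, z) \<in> parcs G" "grundy G z = 1"
  shows "2 \<le> grundy G x"
  using grundy_option_neq[OF assms(1)] grundy_option_neq[OF assms(3)] assms(2,4) by linarith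

text \<open>The options have the same set of normal values as of misere values, so the two mex
  agree. A non-swap option adds one common value to both sets; a swap option adds only 0 and 1, and
  then \<open>both\<close> puts 0 and 1 into each set. The criterion serves a single miserable game
  as well as the sum.\<close>

lemma grundy_eq_misere_grundyI:
  assumes not_terminal: "\<not> terminal G x"
    and options: "\<And>y. (x, y) \<in> parcs G \<Longrightarrow> y \<in> swap_positions G \<or> grundy G y = misere_grundy G y"
    and both: "\<And>y. (x, y) \<in> parcs G \<Longrightarrow> y \<in> swap_positions G \<Longrightarrow>
      movable G x (V G 0 1) \<and> movable G x (V G 1 0)"
  shows "grundy G x = misere_grundy G x"
proof -
  have "grundy G y \<in> misere_grundy G ` options G x \<and> misere_grundy G y \<in> grundy G ` options G x"
    if y: "(x, y) \<in> parcs G" for y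
  proof (cases "y \<in> swap_positions G")
    case True
    obtain u v where uv: "(x, u) \<in> parcs G" "u \<in> V G 0 1" "(x, v) \<in> parcs G" "v \<in> V G 1 0"
      using both[OF y True] unfolding movable_def by blast
    then have "{0, 1} \<subseteq> grundy G ` options G x" "{0, 1} \<subseteq> misere_grundy G ` options G x"
      unfolding V_def by (auto simp: image_iff intro: exI[of _ u] exI[of _ v])
    moreover have "grundy G y \<in> {0, 1}" "misere_grundy G y \<in> {0, 1}"
      using True unfolding swap_positions_def V_def by auto
    ultimately show ?thesis by blast
  next
    case False
    with options[OF y] y show ?thesis by (metis imageI mem_Collect_eq)
  qed
  then have "grundy G ` options G x = misere_grundy G ` options G x" by blast
  then show ?thesis using grundy_eq misere_grundy_eq[OF not_terminal] by metis
qed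

end

section \<open>Swap positions of one miserable game\<close>

locale miserable_game = game +
  assumes miserable: "miserable G"
begin

lemma terminal_swap: "x \<in> pverts G \<Longrightarrow> terminal G x \<Longrightarrow> x \<in> swap_positions G"
  by (simp add: swap_positions_iff grundy_terminal misere_grundy_terminal)

lemma movable_both:
  assumes "(x, y) \<in> parcs G" and "y \<in> swap_positions G" and "x \<notin> swap_positions G"
  shows "movable G x (V G 0 1) \<and> movable G x (V G 1 0)"
  using assms miserable in_arcsD1[OF assms(1)]
  unfolding miserable_def movable_def swap_positions_def by blast

lemma grundy_eq_misere_grundy:
  "x \<in> pverts G \<Longrightarrow> x \<notin> swap_positions G \<Longrightarrow> grundy G x = misere_grundy G x"
proof (induction x rule: wf_induct_rule[OF wf_moves])
  case (1 x)
  show ?case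
  proof (rule grundy_eq_misere_grundyI)
    show "\<not> terminal G x" using 1 terminal_swap by blast
  next
    fix y assume y: "(x, y) \<in> parcs G"
    then show "y \<in> swap_positions G \<or> grundy G y = misere_grundy G y"
      using 1(1)[of y] in_arcsD2[OF y] by auto
  qed (use 1 movable_both in blast)
qed

text \<open>One of the two values of \<open>x\<close> is 1, so some option has 0 as its value of
  that kind. The other value of \<open>x\<close> is 0, which options must avoid, so this option has
  unequal values and \<open>grundy_eq_misere_grundy\<close> forces it to be a swap position.\<close>

lemma swap_option:
  assumes x: "x \<in> swap_positions G" and not_terminal: "\<not> terminal G x"
  obtains y where "(x, y) \<in> parcs G" "y \<in> swap_positions G"
proof -
  from x consider "grundy G x = 0" "misere_grundy G x = 1" | "grundy G x = 1" "misere_grundy G x = 0"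
    unfolding swap_positions_def V_def by auto
  then obtain y where y: "(x, y) \<in> parcs G" "grundy G y \<noteq> misere_grundy G y"
  proof cases
    case 1
    with not_terminal obtain y where "(x, y) \<in> parcs G" "misere_grundy G y = 0"
      using less_misere_grundyE[of x 0] by auto
    with 1 grundy_option_neq that show thesis by metis
  next
    case 2
    then obtain y where "(x, y) \<in> parcs G" "grundy G y = 0"
      using less_grundyE[of 0 x] by auto
    with 2 misere_grundy_option_neq that show thesis by metis
  qed
  with that show thesis using grundy_eq_misere_grundy in_arcsD2 by blast
qed

text \<open>The two values of \<open>y\<close> coincide, and the common value must avoid both values
  of \<open>x\<close>, which are 0 and 1 in some order.\<close>

lemma nonswap_option_grundy:
  assumes x: "x \<in> swap_positions G" and y: "(x, y) \<in> parcs G" and "y \<notin> swap_positions G"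
  shows "2 \<le> grundy G y"
  using grundy_option_neq[OF y] misere_grundy_option_neq[OF y] x
    grundy_eq_misere_grundy[OF in_arcsD2[OF y] assms(3)]
  unfolding swap_positions_iff by linarith

end

section \<open>Small normal values in a disjunctive sum\<close>

lemma pverts_disjunctive_sum [simp]:
  "pverts (disjunctive_sum G\<^sub>1 G\<^sub>2) = pverts G\<^sub>1 \<times> pverts G\<^sub>2"
  by (simp add: disjunctive_sum_def)

lemma parcs_disjunctive_sum_iff:
  "((x\<^sub>1, x\<^sub>2), (y\<^sub>1, y\<^sub>2)) \<in> parcs (disjunctive_sum G\<^sub>1 G\<^sub>2) \<longleftrightarrow>
    (x\<^sub>1, y\<^sub>1) \<in> parcs G\<^sub>1 \<and> x\<^sub>2 \<in> pverts G\<^sub>2 \<and> y\<^sub>2 = x\<^sub>2 \<or>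
    x\<^sub>1 \<in> pverts G\<^sub>1 \<and> (x\<^sub>2, y\<^sub>2) \<in> parcs G\<^sub>2 \<and> y\<^sub>1 = x\<^sub>1"
  by (auto simp: disjunctive_sum_def)

locale two_games = G1: game G\<^sub>1 + G2: game G\<^sub>2
  for G\<^sub>1 :: "'a pair_pre_digraph" and G\<^sub>2 :: "'b pair_pre_digraph"
begin

abbreviation "S \<equiv> disjunctive_sum G\<^sub>1 G\<^sub>2"

sublocale S: game S
  by (rule game_disjunctive_sum) unfold_locales

lemma sum_optionE:
  assumes "((x\<^sub>1, x\<^sub>2), p) \<in> parcs S"
  obtains (left) y where "p = (y, x\<^sub>2)" "(x\<^sub>1, y) \<in> parcs G\<^sub>1"
  | (right) y where "p = (x\<^sub>1, y)" "(x\<^sub>2, y) \<in> parcs G\<^sub>2"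
  using assms by (cases p) (auto simp: parcs_disjunctive_sum_iff)

text \<open>The two clauses support each other in the induction: moves out of a pair of small values
  may lead to a mixed pair, and a mixed pair is at least 2 because it has options of values 0 and 1.
  Nothing is claimed when both values are at least 2.\<close>

lemma grundy_sum_below_two:
  assumes "x\<^sub>1 \<in> pverts G\<^sub>1" and "x\<^sub>2 \<in> pverts G\<^sub>2"
  shows "(grundy G\<^sub>1 x\<^sub>1 < 2 \<and> grundy G\<^sub>2 x\<^sub>2 < 2 \<longrightarrow>
      grundy S (x\<^sub>1, x\<^sub>2) = (grundy G\<^sub>1 x\<^sub>1 + grundy G\<^sub>2 x\<^sub>2) mod 2) \<and>
    ((grundy G\<^sub>1 x\<^sub>1 < 2 \<longleftrightarrow> \<not> grundy G\<^sub>2 x\<^sub>2 < 2) \<longrightarrow> 2 \<le> grundy S (x\<^sub>1, x\<^sub>2))"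
  using assms
proof (induction "(x\<^sub>1, x\<^sub>2)" arbitrary: x\<^sub>1 x\<^sub>2 rule: wf_induct_rule[OF S.wf_moves])
  case (1 x\<^sub>1 x\<^sub>2)
  let ?g = "grundy S (x\<^sub>1, x\<^sub>2)" and ?a = "grundy G\<^sub>1 x\<^sub>1" and ?b = "grundy G\<^sub>2 x\<^sub>2"
  have optl: "((x\<^sub>1, x\<^sub>2), (y, x\<^sub>2)) \<in> parcs S"
    "grundy G\<^sub>1 y < 2 \<Longrightarrow> ?b < 2 \<Longrightarrow> grundy S (y, x\<^sub>2) = (grundy G\<^sub>1 y + ?b) mod 2"
    "(grundy G\<^sub>1 y < 2 \<longleftrightarrow> \<not> ?b < 2) \<Longrightarrow> 2 \<le> grundy S (y, x\<^sub>2)"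
    if "(x\<^sub>1, y) \<in> parcs G\<^sub>1" for y
    using 1 that G1.in_arcsD2[OF that] by (auto simp: parcs_disjunctive_sum_iff)
  have optr: "((x\<^sub>1, x\<^sub>2), (x\<^sub>1, y)) \<in> parcs S"
    "?a < 2 \<Longrightarrow> grundy G\<^sub>2 y < 2 \<Longrightarrow> grundy S (x\<^sub>1, y) = (?a + grundy G\<^sub>2 y) mod 2"
    "(?a < 2 \<longleftrightarrow> \<not> grundy G\<^sub>2 y < 2) \<Longrightarrow> 2 \<le> grundy S (x\<^sub>1, y)"
    if "(x\<^sub>2, y) \<in> parcs G\<^sub>2" for y
    using 1 that G2.in_arcsD2[OF that] by (auto simp: parcs_disjunctive_sum_iff)
  show ?case
  proof (intro conjI impI)
    assume ab: "?a < 2 \<and> ?b < 2"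
    \<comment> \<open>A move changes the value of just one coordinate: either it stays below 2 and
      the parity flips, or it becomes at least 2 and the mixed clause applies.\<close>
    have neq: "grundy S p \<noteq> (?a + ?b) mod 2" if "((x\<^sub>1, x\<^sub>2), p) \<in> parcs S" for p
      using that
    proof (cases rule: sum_optionE)
      case (left y)
      then have "grundy G\<^sub>1 y \<noteq> ?a" by (simp add: G1.grundy_option_neq)
      then show ?thesis
        using optl(2-3)[OF left(2)] ab left(1) by (cases "grundy G\<^sub>1 y < 2") (auto simp: less_2_cases_iff)
    next
      case (right y)
      then have "grundy G\<^sub>2 y \<noteq> ?b" by (simp add: G2.grundy_option_neq)
      then show ?thesis
        using optr(2-3)[OF right(2)] ab right(1) by (cases "grundy G\<^sub>2 y < 2") (auto simp: less_2_cases_iff)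
    qed
    show "?g = (?a + ?b) mod 2"
    proof (cases "?g" "(?a + ?b) mod 2" rule: linorder_cases)
      case less
      \<comment> \<open>Here the parity is 1, so one coordinate has value 1. Moving it to value 0
        yields an option of the sum with value 0, contradicting \<open>?g = 0\<close>.\<close>
      then have zero: "?g = 0" and "?a = 0 \<and> ?b = 1 \<or> ?a = 1 \<and> ?b = 0"
        using ab by (auto simp: less_2_cases_iff)
      then consider y where "(x\<^sub>1, y) \<in> parcs G\<^sub>1" "grundy G\<^sub>1 y = 0" "?b = 0"
        | y where "(x\<^sub>2, y) \<in> parcs G\<^sub>2" "grundy G\<^sub>2 y = 0" "?a = 0"
        using G1.less_grundyE[of 0 x\<^sub>1] G2.less_grundyE[of 0 x\<^sub>2] by (metis zero_less_one)
      then show ?thesis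
      proof cases
        case 1
        then show ?thesis using optl[OF 1(1)] S.grundy_option_neq zero by fastforce
      next
        case 2
        then show ?thesis using optr[OF 2(1)] S.grundy_option_neq zero by fastforce
      qed
    next
      case greater
      then show ?thesis using S.less_grundyE neq by metis
    qed simp
  next
    assume mixed: "?a < 2 \<longleftrightarrow> \<not> ?b < 2"
    \<comment> \<open>\<open>c\<close> stands for the small value of the coordinate that is left
      alone; moving the other coordinate to values 0 and 1 produces both parities, whichever
      \<open>c\<close> is.\<close>
    have two: "2 \<le> ?g"
      if "((x\<^sub>1, x\<^sub>2), p) \<in> parcs S" "grundy S p = c mod 2"
        "((x\<^sub>1, x\<^sub>2), q) \<in> parcs S" "grundy S q = Suc c mod 2" for p q c
      using that S.two_le_grundyI[of _ p q] S.two_le_grundyI[of _ q p]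
      by (cases "even c") (auto simp: even_iff_mod_2_eq_zero odd_iff_mod_2_eq_one mod_Suc)
    show "2 \<le> ?g"
    proof (cases "?a < 2")
      case True
      with mixed have "0 < ?b" "1 < ?b" by auto
      then obtain y z where "(x\<^sub>2, y) \<in> parcs G\<^sub>2" "grundy G\<^sub>2 y = 0"
        "(x\<^sub>2, z) \<in> parcs G\<^sub>2" "grundy G\<^sub>2 z = 1"
        by (metis G2.less_grundyE)
      then show ?thesis
        using True two[of "(x\<^sub>1, y)" ?a "(x\<^sub>1, z)"] optr by simp
    next
      case False
      with mixed have "0 < ?a" "1 < ?a" "?b < 2" by auto
      then obtain y z where "(x\<^sub>1, y) \<in> parcs G\<^sub>1" "grundy G\<^sub>1 y = 0"
        "(x\<^sub>1, z) \<in> parcs G\<^sub>1" "grundy G\<^sub>1 z = 1"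
        by (metis G1.less_grundyE)
      then show ?thesis
        using \<open>?b < 2\<close> two[of "(y, x\<^sub>2)" ?b "(z, x\<^sub>2)"] optl by simp
    qed
  qed
qed

end

section \<open>Swap pairs in the sum of two miserable games\<close>

locale two_miserable_games =
  two_games G\<^sub>1 G\<^sub>2 + G1: miserable_game G\<^sub>1 + G2: miserable_game G\<^sub>2
  for G\<^sub>1 :: "'a pair_pre_digraph" and G\<^sub>2 :: "'b pair_pre_digraph"
begin

abbreviation "swap_pairs \<equiv> swap_positions G\<^sub>1 \<times> swap_positions G\<^sub>2"

lemma grundy_swap_pair:
  "(x\<^sub>1, x\<^sub>2) \<in> swap_pairs \<Longrightarrow> grundy S (x\<^sub>1, x\<^sub>2) = (grundy G\<^sub>1 x\<^sub>1 + grundy G\<^sub>2 x\<^sub>2) mod 2"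
  using grundy_sum_below_two by (auto simp: G1.swap_positions_iff G2.swap_positions_iff)

text \<open>The moved coordinate has left the swap positions, so its value is at least 2, while the
  other value is still below 2: a mixed pair.\<close>

lemma swap_pair_option_grundy:
  assumes x: "(x\<^sub>1, x\<^sub>2) \<in> swap_pairs" and p: "((x\<^sub>1, x\<^sub>2), p) \<in> parcs S" and "p \<notin> swap_pairs"
  shows "2 \<le> grundy S p"
  using p
proof (cases rule: sum_optionE)
  case (left y)
  with assms have "2 \<le> grundy G\<^sub>1 y" by (auto intro: G1.nonswap_option_grundy)
  with left x show ?thesis
    using grundy_sum_below_two[of y x\<^sub>2] by (auto simp: G2.swap_positions_iff dest: G1.in_arcsD2)
next
  case (right y)
  with assms have "2 \<le> grundy G\<^sub>2 y" by (auto intro: G2.nonswap_option_grundy)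
  with right x show ?thesis
    using grundy_sum_below_two[of x\<^sub>1 y] by (auto simp: G1.swap_positions_iff dest: G2.in_arcsD2)
qed

lemma swap_pair_option:
  assumes x: "(x\<^sub>1, x\<^sub>2) \<in> swap_pairs" and "\<not> terminal S (x\<^sub>1, x\<^sub>2)"
  obtains p where "((x\<^sub>1, x\<^sub>2), p) \<in> parcs S" "p \<in> swap_pairs"
proof -
  have vert: "x\<^sub>1 \<in> pverts G\<^sub>1" "x\<^sub>2 \<in> pverts G\<^sub>2"
    using x by (auto simp: G1.swap_positions_iff G2.swap_positions_iff)
  have "\<not> terminal G\<^sub>1 x\<^sub>1 \<or> \<not> terminal G\<^sub>2 x\<^sub>2"
    using assms(2) by (auto simp: terminal_def parcs_disjunctive_sum_iff)
  then show thesis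
  proof
    assume "\<not> terminal G\<^sub>1 x\<^sub>1"
    with x obtain y where "(x\<^sub>1, y) \<in> parcs G\<^sub>1" "y \<in> swap_positions G\<^sub>1"
      using G1.swap_option by blast
    with x vert that[of "(y, x\<^sub>2)"] show thesis by (auto simp: parcs_disjunctive_sum_iff)
  next
    assume "\<not> terminal G\<^sub>2 x\<^sub>2"
    with x obtain y where "(x\<^sub>2, y) \<in> parcs G\<^sub>2" "y \<in> swap_positions G\<^sub>2"
      using G2.swap_option by blast
    with x vert that[of "(x\<^sub>1, y)"] show thesis by (auto simp: parcs_disjunctive_sum_iff)
  qed
qed

text \<open>The coordinate that the move to \<open>p\<close> leaves alone is already a swap
  position, so the moved one is not. Miserability then lets that coordinate reach swap positions of
  either normal value, hence both parities.\<close>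

lemma nonswap_pair_movable:
  assumes p: "((x\<^sub>1, x\<^sub>2), p) \<in> parcs S" and "p \<in> swap_pairs" and "(x\<^sub>1, x\<^sub>2) \<notin> swap_pairs" and "g < 2"
  obtains q where "((x\<^sub>1, x\<^sub>2), q) \<in> parcs S" "q \<in> swap_pairs" "grundy S q = g"
  using p
proof (cases rule: sum_optionE)
  case (left y)
  with assms have x: "movable G\<^sub>1 x\<^sub>1 (V G\<^sub>1 0 1)" "movable G\<^sub>1 x\<^sub>1 (V G\<^sub>1 1 0)" "x\<^sub>2 \<in> swap_positions G\<^sub>2"
    using G1.movable_both by auto
  \<comment> \<open>The value to aim for in the first game: modulo 2, adding
    \<open>grundy G\<^sub>2 x\<^sub>2\<close> once more gives \<open>g\<close>.\<close>
  have "(g + grundy G\<^sub>2 x\<^sub>2) mod 2 = 0 \<or> (g + grundy G\<^sub>2 x\<^sub>2) mod 2 = 1" by presburger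
  with x obtain z where z: "(x\<^sub>1, z) \<in> parcs G\<^sub>1" "z \<in> swap_positions G\<^sub>1"
    "grundy G\<^sub>1 z = (g + grundy G\<^sub>2 x\<^sub>2) mod 2"
    unfolding movable_def swap_positions_def V_def by auto
  have "grundy S (z, x\<^sub>2) = g"
    using grundy_swap_pair[of z x\<^sub>2] z x \<open>g < 2\<close> by simp presburger
  with that[of "(z, x\<^sub>2)"] z x show thesis
    by (auto simp: parcs_disjunctive_sum_iff G2.swap_positions_iff)
next
  case (right y)
  with assms have x: "movable G\<^sub>2 x\<^sub>2 (V G\<^sub>2 0 1)" "movable G\<^sub>2 x\<^sub>2 (V G\<^sub>2 1 0)" "x\<^sub>1 \<in> swap_positions G\<^sub>1"
    using G2.movable_both by auto
  have "(g + grundy G\<^sub>1 x\<^sub>1) mod 2 = 0 \<or> (g + grundy G\<^sub>1 x\<^sub>1) mod 2 = 1" by presburger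
  with x obtain z where z: "(x\<^sub>2, z) \<in> parcs G\<^sub>2" "z \<in> swap_positions G\<^sub>2"
    "grundy G\<^sub>2 z = (g + grundy G\<^sub>1 x\<^sub>1) mod 2"
    unfolding movable_def swap_positions_def V_def by auto
  have "grundy S (x\<^sub>1, z) = g"
    using grundy_swap_pair[of x\<^sub>1 z] z x \<open>g < 2\<close> by simp presburger
  with that[of "(x\<^sub>1, z)"] z x show thesis
    by (auto simp: parcs_disjunctive_sum_iff G1.swap_positions_iff)
qed

text \<open>The last assumption abstracts the induction hypothesis of \<open>sum_dichotomy\<close>,
  so that the same fact can be reused for \<open>miserable_sum\<close> once the swap positions of
  the sum are known.\<close>

lemma movable_sum_both:
  assumes "(x, p) \<in> parcs S" and "p \<in> swap_pairs" and "x \<notin> swap_pairs"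
    and "\<And>q. (x, q) \<in> parcs S \<Longrightarrow> q \<in> swap_pairs \<Longrightarrow> q \<in> swap_positions S"
  shows "movable S x (V S 0 1) \<and> movable S x (V S 1 0)"
proof -
  obtain x\<^sub>1 x\<^sub>2 where x: "x = (x\<^sub>1, x\<^sub>2)" by fastforce
  obtain q r where "(x, q) \<in> parcs S" "q \<in> swap_pairs" "grundy S q = 0"
    "(x, r) \<in> parcs S" "r \<in> swap_pairs" "grundy S r = 1"
    using nonswap_pair_movable[of x\<^sub>1 x\<^sub>2 p 0] nonswap_pair_movable[of x\<^sub>1 x\<^sub>2 p 1] assms(1-3)
    unfolding x by (metis one_less_numeral_iff pos2 semiring_norm(76))
  with assms(4)[of q] assms(4)[of r] show ?thesis
    unfolding movable_def swap_positions_def V_def by (auto intro: bexI[of _ q] bexI[of _ r])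
qed

lemma sum_dichotomy:
  "x \<in> pverts S \<Longrightarrow> if x \<in> swap_pairs then x \<in> swap_positions S else grundy S x = misere_grundy S x"
proof (induction x rule: wf_induct_rule[OF S.wf_moves])
  case (1 x)
  obtain x\<^sub>1 x\<^sub>2 where x: "x = (x\<^sub>1, x\<^sub>2)" by fastforce
  have options: "if p \<in> swap_pairs then p \<in> swap_positions S else grundy S p = misere_grundy S p"
    if "(x, p) \<in> parcs S" for p
    using 1(1)[of p] that S.in_arcsD2[OF that] by auto
  show ?case
  proof (cases "x \<in> swap_pairs")
    case True
    then have below: "grundy S x < 2" unfolding x using grundy_swap_pair by auto
    have "misere_grundy S x = 1 - grundy S x"
    proof (cases "terminal S x")
      case True
      then show ?thesis by (simp add: S.grundy_terminal S.misere_grundy_terminal)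
    next
      case False
      \<comment> \<open>The normal value of \<open>p\<close> is below 2 and differs from that of
        \<open>x\<close>, so it is \<open>1 - grundy S x\<close>; swapping gives the misere
        value.\<close>
      have swap: "misere_grundy S p = grundy S x" if "(x, p) \<in> parcs S" "p \<in> swap_pairs" for p
        using options[OF that(1)] that(2) S.grundy_option_neq[OF that(1)] below
        by (auto simp: S.swap_positions_iff)
      have nonswap: "2 \<le> misere_grundy S p" if "(x, p) \<in> parcs S" "p \<notin> swap_pairs" for p
        using options[OF that(1)] swap_pair_option_grundy[of x\<^sub>1 x\<^sub>2 p] that \<open>x \<in> swap_pairs\<close>
        unfolding x by auto
      obtain p where p: "(x, p) \<in> parcs S" "p \<in> swap_pairs"
        using swap_pair_option[of x\<^sub>1 x\<^sub>2] \<open>x \<in> swap_pairs\<close> False unfolding x by blast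
      \<comment> \<open>By \<open>swap\<close> and \<open>nonswap\<close>, the misere values of the
        options are \<open>grundy S x\<close>, attained at \<open>p\<close>, and possibly numbers
        from 2 on. The attained value matters when \<open>grundy S x\<close> is 0, since then 0 must
        be excluded to reach mex 1.\<close>
      have "mex (misere_grundy S ` options S x) = 1 - grundy S x"
      proof (rule mex_eqI)
        show "1 - grundy S x \<notin> misere_grundy S ` options S x"
        proof
          assume "1 - grundy S x \<in> misere_grundy S ` options S x"
          then obtain q where "(x, q) \<in> parcs S" "misere_grundy S q = 1 - grundy S x" by auto
          moreover have "1 - grundy S x \<noteq> grundy S x" by presburger
          ultimately show False using swap[of q] nonswap[of q] by (cases "q \<in> swap_pairs") auto
        qed
      next
        fix m assume "m < 1 - grundy S x"
        then have "m = misere_grundy S p" using swap[OF p] by simp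
        with p show "m \<in> misere_grundy S ` options S x" by blast
      qed
      then show ?thesis using S.misere_grundy_eq[OF False] by simp
    qed
    with True below 1(2) show ?thesis by (simp add: S.swap_positions_iff)
  next
    case False
    have "grundy S x = misere_grundy S x"
    proof (rule S.grundy_eq_misere_grundyI)
      show "\<not> terminal S x"
      proof
        assume "terminal S x"
        then have "terminal G\<^sub>1 x\<^sub>1" "terminal G\<^sub>2 x\<^sub>2"
          using 1(2) unfolding x terminal_def by (auto simp: parcs_disjunctive_sum_iff)
        then show False using False 1(2) G1.terminal_swap G2.terminal_swap unfolding x by auto
      qed
    next
      fix p assume "(x, p) \<in> parcs S"
      then show "p \<in> swap_positions S \<or> grundy S p = misere_grundy S p"
        using options by metis
    next
      fix p assume p: "(x, p) \<in> parcs S" "p \<in> swap_positions S"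
      \<comment> \<open>Otherwise the dichotomy for \<open>p\<close> would make its two values
        equal, which no swap position allows.\<close>
      then have "p \<in> swap_pairs"
        using options[OF p(1)] by (auto dest: S.swap_positions_neq split: if_splits)
      then show "movable S x (V S 0 1) \<and> movable S x (V S 1 0)"
        using movable_sum_both[OF p(1) _ False] options by meson
    qed
    with False show ?thesis by simp
  qed
qed

text \<open>The alternatives of \<open>sum_dichotomy\<close> exclude each other, since a swap
  position has unequal values; outside the vertices both sides are false.\<close>

lemma swap_positions_sum: "swap_positions S = swap_pairs"
proof (rule set_eqI)
  fix x
  show "x \<in> swap_positions S \<longleftrightarrow> x \<in> swap_pairs"
  proof (cases "x \<in> pverts S")
    case True
    then show ?thesis
      using sum_dichotomy[OF True] by (auto dest: S.swap_positions_neq split: if_splits)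
  next
    case False
    then show ?thesis
      by (auto simp: S.swap_positions_iff G1.swap_positions_iff G2.swap_positions_iff)
  qed
qed

lemma miserable_sum: "miserable S"
  unfolding miserable_def swap_positions_def[symmetric]
  using movable_sum_both unfolding movable_def swap_positions_sum by blast

text \<open>On swap pairs the normal value is the parity of the sum, and it is odd exactly when one
  coordinate has value 1 and the other 0; being swap positions fixes the misere values.\<close>

lemma V_sum_1_0: "V S 1 0 = V G\<^sub>1 1 0 \<times> V G\<^sub>2 0 1 \<union> V G\<^sub>1 0 1 \<times> V G\<^sub>2 1 0"
proof -
  have "V S 1 0 = {p \<in> swap_positions S. grundy S p = 1}"
    unfolding swap_positions_def V_def by auto
  also have "\<dots> = {(x\<^sub>1, x\<^sub>2). (x\<^sub>1, x\<^sub>2) \<in> swap_pairs \<and> (grundy G\<^sub>1 x\<^sub>1 + grundy G\<^sub>2 x\<^sub>2) mod 2 = 1}"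
    unfolding swap_positions_sum using grundy_swap_pair by auto
  also have "\<dots> = V G\<^sub>1 1 0 \<times> V G\<^sub>2 0 1 \<union> V G\<^sub>1 0 1 \<times> V G\<^sub>2 1 0"
    unfolding swap_positions_def V_def by auto
  finally show ?thesis .
qed

end

theorem theorem5p3:
  fixes G\<^sub>1 :: "'a pair_pre_digraph" and G\<^sub>2 :: "'b pair_pre_digraph"
  assumes "game G\<^sub>1" and "game G\<^sub>2"
    and "miserable G\<^sub>1" and "miserable G\<^sub>2"
  shows "miserable (disjunctive_sum G\<^sub>1 G\<^sub>2) \<and>
    (\<forall>x\<^sub>1\<in>pverts G\<^sub>1. \<forall>x\<^sub>2\<in>pverts G\<^sub>2.
      ((x\<^sub>1, x\<^sub>2) \<in> swap_positions (disjunctive_sum G\<^sub>1 G\<^sub>2) \<longleftrightarrow>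
        x\<^sub>1 \<in> swap_positions G\<^sub>1 \<and> x\<^sub>2 \<in> swap_positions G\<^sub>2) \<and>
      ((x\<^sub>1, x\<^sub>2) \<in> V (disjunctive_sum G\<^sub>1 G\<^sub>2) 1 0 \<longleftrightarrow>
        (x\<^sub>1 \<in> V G\<^sub>1 1 0 \<and> x\<^sub>2 \<in> V G\<^sub>2 0 1) \<or> (x\<^sub>1 \<in> V G\<^sub>1 0 1 \<and> x\<^sub>2 \<in> V G\<^sub>2 1 0)))"
proof -
  interpret two_miserable_games G\<^sub>1 G\<^sub>2
    using assms by (simp add: two_miserable_games_def two_games_def miserable_game_def miserable_game_axioms_def)
  show ?thesis
    using miserable_sum unfolding swap_positions_sum V_sum_1_0 by auto
qed

end
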